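(* Let $\mathcal{H}$ be a complex Hilbert space and let $T\in\mathcal{B}(\mathcal{H})$. Suppose that there are two positive constants $m$ and $M$ such that, for every integer $N\ge 1$ and every $x\in\mathcal{H}$, $$m^2\|x\|^2 \le \frac{1}{N}\sum_{n=0}^{N-1}\|T^nx\|^2 \le M^2\|x\|^2 .$$ Then $T$ is similar to an isometry.
   Context: $\mathcal{B}(\mathcal{H})$ denotes the algebra of bounded linear operators on the Hilbert space $\mathcal{H}$. An operator $T\in\mathcal{B}(\mathcal{H})$ is similar to an isometry if there is an invertible $L\in\mathcal{B}(\mathcal{H})$ such that $L^{-1}TL$ is an isometry of $\mathcal{H}$ (i.e. $\|L^{-1}TLx\|=\|x\|$ for all $x\in\mathcal{H}$; surjectivity is not required). *)

theory Defs
  imports "HOL-Analysis.Analysis"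
begin

class complex_vector = real_vector +
  fixes scaleC :: "complex \<Rightarrow> 'a \<Rightarrow> 'a"  (infixr "*\<^sub>C" 75)
  assumes scaleC_add_right: "a *\<^sub>C (x + y) = a *\<^sub>C x + a *\<^sub>C y"
    and scaleC_add_left: "(a + b) *\<^sub>C x = a *\<^sub>C x + b *\<^sub>C x"
    and scaleC_scaleC: "a *\<^sub>C b *\<^sub>C x = (a * b) *\<^sub>C x"
    and scaleC_one: "1 *\<^sub>C x = x"
    and scaleC_of_real: "complex_of_real r *\<^sub>C x = r *\<^sub>R x"

(* The inner product is linear in its first argument and conjugate-linear in the second.
   By cinner_commute, cinner x x is real. *)
class complex_inner = complex_vector + real_normed_vector +
  fixes cinner :: "'a \<Rightarrow> 'a \<Rightarrow> complex"
  assumes cinner_commute: "cinner x y = cnj (cinner y x)"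
    and cinner_add_left: "cinner (x + y) z = cinner x z + cinner y z"
    and cinner_scaleC_left: "cinner (c *\<^sub>C x) y = c * cinner x y"
    and cinner_self_nonneg: "0 \<le> Re (cinner x x)"
    and cinner_eq_zero_iff: "cinner x x = 0 \<longleftrightarrow> x = 0"
    and norm_eq_sqrt_cinner: "norm x = sqrt (Re (cinner x x))"

class chilbert_space = complex_inner + complete_space

instantiation complex :: chilbert_space
begin

definition scaleC_complex :: "complex \<Rightarrow> complex \<Rightarrow> complex"
  where "scaleC_complex c z = c * z"

definition cinner_complex :: "complex \<Rightarrow> complex \<Rightarrow> complex"
  where "cinner_complex z w = z * cnj w"

instance
  by standard
    (auto simp: scaleC_complex_def cinner_complex_def algebra_simps scaleR_conv_of_real
      cmod_def power2_eq_square)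

end

definition bounded_clinear :: "('a::complex_inner \<Rightarrow> 'b::complex_inner) \<Rightarrow> bool"
  where "bounded_clinear T \<longleftrightarrow> bounded_linear T \<and> (\<forall>c x. T (c *\<^sub>C x) = c *\<^sub>C T x)"

(* L' is the inverse of L; an isometry need not be surjective. *)
definition similar_to_isometry :: "('a::complex_inner \<Rightarrow> 'a) \<Rightarrow> bool"
  where "similar_to_isometry T \<longleftrightarrow>
    (\<exists>(L :: 'a \<Rightarrow> 'a) (L' :: 'a \<Rightarrow> 'a).
      bounded_clinear L \<and> bounded_clinear L' \<and> L \<circ> L' = id \<and> L' \<circ> L = id \<and>
      (\<forall>x. norm ((L' \<circ> T \<circ> L) x) = norm x))"

end

theory Submission
  imports Defs
begin

text \<open>
  Comparing the lower mean bound at \<open>T\<^sup>k x\<close> with the upper mean bound at \<open>x\<close> shows that \<open>T\<close>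
  is power bounded. Hence a limit, along a filter provided by Tychonoff's theorem, of the
  Cesaro means of the forms \<open>Re (cinner (T\<^sup>n x) (T\<^sup>n y))\<close> is a \<open>T\<close>-invariant form equivalent to the
  original inner product. After division by \<open>M\<^sup>2\<close> it is represented by a selfadjoint operator
  \<open>1 - B\<close> with \<open>norm B < 1\<close>, whose square root \<open>L\<close> is obtained as a fixed point of a contraction;
  \<open>T\<close> is isometric for the norm of \<open>L x\<close>, so \<open>L T L\<^sup>-\<^sup>1\<close> is an isometry. Only the real part
  of the inner product is used: complex linearity amounts to commuting with scalars.
\<close>

instance chilbert_space \<subseteq> banach ..

section \<open>The real inner product and positive semidefinite forms\<close>

definition rinner :: "'a::complex_inner \<Rightarrow> 'a \<Rightarrow> real"
  where "rinner x y = Re (cinner x y)"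

lemma rinner_commute: "rinner x y = rinner y x"
  using cinner_commute[of x y] by (simp add: rinner_def)

text \<open>The adjoint of multiplication by \<open>c\<close> is multiplication by
  \<open>cnj c\<close>. This identity, shared by every form below, is what turns into complex
  linearity of the representing operators.\<close>

lemma rinner_scaleC_left: "rinner (c *\<^sub>C x) y = rinner x (cnj c *\<^sub>C y)"
proof -
  have "cinner x (cnj c *\<^sub>C y) = c * cinner x y"
    by (subst cinner_commute, subst cinner_scaleC_left, subst cinner_commute) simp
  then show ?thesis
    by (simp add: rinner_def cinner_scaleC_left)
qed

lemma rinner_add_left: "rinner (x + y) z = rinner x z + rinner y z"
  by (simp add: rinner_def cinner_add_left)

lemma rinner_scaleR_left: "rinner (r *\<^sub>R x) y = r * rinner x y"
  by (simp add: rinner_def cinner_scaleC_left flip: scaleC_of_real)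

lemma bilinear_symmetricI:
  assumes sym: "\<And>x y. f x y = f y x"
    and add: "\<And>x y z. f (x + y) z = f x z + f y z"
    and scale: "\<And>r x y. f (r *\<^sub>R x) y = r *\<^sub>R f x y"
  shows "bilinear f"
proof -
  have "linear (\<lambda>x. f x y)" for y
    by (intro linearI add scale)
  moreover have "f x = (\<lambda>y. f y x)" for x
    using sym by blast
  ultimately show ?thesis
    unfolding bilinear_def by metis
qed

lemma bilinear_rinner: "bilinear rinner"
  by (rule bilinear_symmetricI) (auto simp: rinner_add_left rinner_scaleR_left intro: rinner_commute)

lemma rinner_self: "rinner x x = (norm x)\<^sup>2"
  by (simp add: rinner_def norm_eq_sqrt_cinner cinner_self_nonneg)

text \<open>First-order condition at a minimum: for small \<open>t\<close> of sign opposite to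
  \<open>b\<close> the linear term would win.\<close>

lemma linear_coeff_eq_0:
  fixes b c :: real
  assumes nonneg: "\<And>t. 0 \<le> t * b + t\<^sup>2 * c"
  shows "b = 0"
proof (rule ccontr)
  assume "b \<noteq> 0"
  \<comment> \<open>Chosen so that \<open>t * b + t\<^sup>2 * (\<bar>c\<bar> + 1) = 0\<close>;
    replacing \<open>\<bar>c\<bar> + 1\<close> by \<open>c\<close> makes the value strictly
    negative.\<close>
  define t where "t = - b / (\<bar>c\<bar> + 1)"
  have "t * b + t\<^sup>2 * c \<le> t * b + t\<^sup>2 * \<bar>c\<bar>"
    by (simp add: mult_left_mono)
  also have "\<dots> < t * b + t\<^sup>2 * (\<bar>c\<bar> + 1)"
    using \<open>b \<noteq> 0\<close> by (simp add: t_def distrib_left)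
  also have "\<dots> = t * b + t * (t * (\<bar>c\<bar> + 1))"
    by (simp add: power2_eq_square)
  also have "t * (\<bar>c\<bar> + 1) = - b"
    using abs_ge_zero[of c] by (simp add: t_def)
  finally show False
    using nonneg[of t] by simp
qed

lemma psd_form_Cauchy_Schwarz:
  fixes \<beta> :: "'a::real_vector \<Rightarrow> 'a \<Rightarrow> real"
  assumes bil: "bilinear \<beta>" and sym: "\<And>x y. \<beta> x y = \<beta> y x" and nonneg: "\<And>x. 0 \<le> \<beta> x x"
  shows "(\<beta> x y)\<^sup>2 \<le> \<beta> x x * \<beta> y y"
proof -
  have expand: "\<beta> (x + t *\<^sub>R y) (x + t *\<^sub>R y) = \<beta> x x + 2 * t * \<beta> x y + t\<^sup>2 * \<beta> y y" for t
    using sym[of y x]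
    by (simp add: bilinear_ladd[OF bil] bilinear_radd[OF bil] bilinear_lmul[OF bil]
        bilinear_rmul[OF bil] power2_eq_square algebra_simps)
  show ?thesis
  proof (cases "\<beta> y y = 0")
    case True
    have "\<beta> x y = 0"
    proof (rule ccontr)
      assume "\<beta> x y \<noteq> 0"
      \<comment> \<open>With \<open>\<beta> y y = 0\<close> the expansion is affine in
        \<open>t\<close>, and this scalar gives it the value -1.\<close>
      then show False
        using nonneg[of "x + (- (\<beta> x x + 1) / (2 * \<beta> x y)) *\<^sub>R y"] True
        by (simp add: expand field_simps)
    qed
    then show ?thesis
      by (simp add: True)
  next
    case False
    then have "\<beta> y y > 0"
      using nonneg[of y] by simp
    \<comment> \<open>The scalar minimises the quadratic polynomial in \<open>t\<close>.\<close>
    then show ?thesis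
      using nonneg[of "x + (- \<beta> x y / \<beta> y y) *\<^sub>R y", unfolded expand]
      by (simp add: power2_eq_square field_simps)
  qed
qed

lemma psd_form_bound:
  fixes \<beta> :: "'a::real_normed_vector \<Rightarrow> 'a \<Rightarrow> real"
  assumes "bilinear \<beta>" "\<And>x y. \<beta> x y = \<beta> y x" "\<And>x. 0 \<le> \<beta> x x"
    and upper: "\<And>x. \<beta> x x \<le> r * (norm x)\<^sup>2" and "0 \<le> r"
  shows "\<bar>\<beta> x y\<bar> \<le> r * norm x * norm y"
proof -
  have "\<bar>\<beta> x y\<bar>\<^sup>2 \<le> \<beta> x x * \<beta> y y"
    using psd_form_Cauchy_Schwarz[OF assms(1-3)] by simp
  also have "\<dots> \<le> (r * (norm x)\<^sup>2) * (r * (norm y)\<^sup>2)"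
    by (intro mult_mono upper assms) (use \<open>0 \<le> r\<close> in auto)
  also have "\<dots> = (r * norm x * norm y)\<^sup>2"
    by (simp add: power2_eq_square)
  finally show ?thesis
    by (rule power2_le_imp_le) (use \<open>0 \<le> r\<close> in auto)
qed

lemma rinner_bound: "\<bar>rinner x y\<bar> \<le> norm x * norm y"
  using psd_form_bound[OF bilinear_rinner rinner_commute, of 1 x y] by (simp add: rinner_self)

lemma bounded_bilinear_rinner: "bounded_bilinear rinner"
  by (rule bounded_bilinear.intro)
    (auto simp: bilinear_ladd[OF bilinear_rinner] bilinear_radd[OF bilinear_rinner]
      bilinear_lmul[OF bilinear_rinner] bilinear_rmul[OF bilinear_rinner]
      intro!: exI[of _ 1] rinner_bound)

interpretation rinner: bounded_bilinear rinner
  by (rule bounded_bilinear_rinner)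

lemma rinner_left_cancel:
  assumes "\<And>z. rinner x z = rinner y z"
  shows "x = y"
proof -
  have "rinner (x - y) (x - y) = 0"
    using assms by (simp add: rinner.diff_left)
  then show ?thesis
    by (simp add: rinner_self)
qed

section \<open>Operators representing bounded forms\<close>

text \<open>The representing vector minimises the functional mapping \<open>y\<close> to \<open>(norm y)\<^sup>2 - 2 * f y\<close>.\<close>

lemma Riesz_representation:
  fixes f :: "'a::chilbert_space \<Rightarrow> real"
  assumes "bounded_linear f"
  shows "\<exists>v. \<forall>y. rinner v y = f y"
proof -
  interpret f: bounded_linear f by fact
  define J where "J y = (norm y)\<^sup>2 - 2 * f y" for y
  obtain K where K: "\<And>y. norm (f y) \<le> norm y * K"
    using f.bounded by blast
  \<comment> \<open>Completing the square in \<open>norm y\<close>.\<close>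
  have below: "- K\<^sup>2 \<le> J y" for y
  proof -
    have "f y \<le> norm y * K"
      using K[of y] by simp
    moreover have "0 \<le> (norm y - K)\<^sup>2"
      by simp
    ultimately show ?thesis
      by (simp add: J_def power2_diff)
  qed
  define d where "d = (INF y. J y)"
  have bdd: "bdd_below (range J)"
    using below by (auto intro: bdd_belowI[of _ "- K\<^sup>2"])
  have d_le: "d \<le> J y" for y
    unfolding d_def by (rule cINF_lower[OF bdd]) simp
  have "\<exists>y. J y < d + 1 / real (Suc n)" for n
    using cINF_less_iff[of UNIV J "d + 1 / real (Suc n)"] bdd unfolding d_def by auto
  then obtain u where u: "\<And>n. J (u n) < d + 1 / real (Suc n)"
    by metis
  \<comment> \<open>The linear part of \<open>J\<close> cancels at the midpoint, which leaves the
    parallelogram law; the value of \<open>J\<close> at the midpoint is at least \<open>d\<close>.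
    Hence minimising sequences are Cauchy.\<close>
  have parallelogram: "(norm (x - y))\<^sup>2 \<le> 2 * (J x - d) + 2 * (J y - d)" for x y
  proof -
    have "(norm (x - y))\<^sup>2 = 2 * J x + 2 * J y - 4 * J ((1/2) *\<^sub>R (x + y))"
      unfolding J_def rinner_self[symmetric]
      by (simp add: rinner.add_left rinner.add_right rinner.diff_left rinner.diff_right
          rinner.scaleR_left rinner.scaleR_right f.add f.scaleR rinner_commute[of y x]
          algebra_simps)
    then show ?thesis
      using d_le[of "(1/2) *\<^sub>R (x + y)"] by simp
  qed
  have "Cauchy u"
  proof (rule metric_CauchyI)
    fix e :: real assume "0 < e"
    \<comment> \<open>\<open>parallelogram\<close> doubles each of the two excesses, so a quarter of
      the square of \<open>e\<close> suffices.\<close>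
    then have "0 < e\<^sup>2 / 4"
      by simp
    then obtain n0 where n0: "inverse (real (Suc n0)) < e\<^sup>2 / 4"
      using reals_Archimedean by blast
    have small: "J (u n) - d < e\<^sup>2 / 4" if "n \<ge> n0" for n
    proof -
      have "1 / real (Suc n) \<le> 1 / real (Suc n0)"
        using that by (intro divide_left_mono) auto
      then show ?thesis
        using u[of n] n0 by (simp add: inverse_eq_divide)
    qed
    have "dist (u k) (u n) < e" if "k \<ge> n0" "n \<ge> n0" for k n
    proof (rule power2_less_imp_less)
      show "(dist (u k) (u n))\<^sup>2 < e\<^sup>2"
        using parallelogram[of "u k" "u n"] small[OF that(1)] small[OF that(2)]
        by (simp add: dist_norm)
    qed (use \<open>0 < e\<close> in simp)
    then show "\<exists>N. \<forall>k\<ge>N. \<forall>n\<ge>N. dist (u k) (u n) < e"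
      by blast
  qed
  then obtain v where v: "u \<longlonglongrightarrow> v"
    by (auto simp: Cauchy_convergent_iff convergent_def)
  have "(\<lambda>n. J (u n)) \<longlonglongrightarrow> J v"
    unfolding J_def by (intro tendsto_intros v f.tendsto)
  moreover have "(\<lambda>n. d + 1 / real (Suc n)) \<longlonglongrightarrow> d + 0"
    by (intro tendsto_add tendsto_const LIMSEQ_Suc[OF lim_1_over_n])
  ultimately have "J v \<le> d + 0"
    by (rule LIMSEQ_le) (use u in \<open>auto intro: less_imp_le\<close>)
  then have min: "J v \<le> J y" for y
    using d_le[of y] by simp
  have "rinner v y = f y" for y
  proof -
    have "2 * (rinner v y - f y) = 0"
    proof (rule linear_coeff_eq_0)
      fix t
      have "J (v + t *\<^sub>R y) - J v = t * (2 * (rinner v y - f y)) + t\<^sup>2 * (norm y)\<^sup>2"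
        unfolding J_def rinner_self[symmetric]
        by (simp add: rinner.add_left rinner.add_right rinner.scaleR_left rinner.scaleR_right
          f.add f.scaleR rinner_commute[of y v] power2_eq_square algebra_simps)
      then show "0 \<le> t * (2 * (rinner v y - f y)) + t\<^sup>2 * (norm y)\<^sup>2"
        using min[of "v + t *\<^sub>R y"] by simp
    qed
    then show ?thesis by simp
  qed
  then show ?thesis by blast
qed

text \<open>Riesz representation is applied for each fixed \<open>x\<close>. Uniqueness of the
  representing vector gives linearity, and testing with \<open>y = b x\<close> gives the norm
  bound.\<close>

lemma bounded_form_operator:
  fixes \<beta> :: "'a::chilbert_space \<Rightarrow> 'a \<Rightarrow> real"
  assumes bil: "bilinear \<beta>" and bound: "\<And>x y. \<bar>\<beta> x y\<bar> \<le> r * norm x * norm y" and "0 \<le> r"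
  obtains B :: "'a \<Rightarrow>\<^sub>L 'a" where "norm B \<le> r" "\<And>x y. rinner (B x) y = \<beta> x y"
proof -
  have "bounded_linear (\<beta> x)" for x
    by (rule bounded_linear_intro[of _ "r * norm x"])
      (use bound[of x] in \<open>auto simp: bilinear_radd[OF bil] bilinear_rmul[OF bil] mult_ac\<close>)
  then have "\<forall>x. \<exists>v. \<forall>y. rinner v y = \<beta> x y"
    using Riesz_representation by blast
  then obtain b where b: "\<And>x y. rinner (b x) y = \<beta> x y"
    by (auto dest!: choice)
  have le: "norm (b x) \<le> norm x * r" for x
  proof (cases "b x = 0")
    case False
    have "norm (b x) * norm (b x) \<le> (norm x * r) * norm (b x)"
      using bound[of x "b x"] b[of x "b x"] by (simp add: rinner_self power2_eq_square mult_ac)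
    then show ?thesis
      using False by simp
  qed (use \<open>0 \<le> r\<close> in simp)
  have "bounded_linear b"
  proof (rule bounded_linear_intro[OF _ _ le])
    show "b (x + y) = b x + b y" for x y
      by (rule rinner_left_cancel) (simp add: rinner.add_left b bilinear_ladd[OF bil])
    show "b (c *\<^sub>R x) = c *\<^sub>R b x" for c x
      by (rule rinner_left_cancel) (simp add: rinner.scaleR_left b bilinear_lmul[OF bil])
  qed
  then have app: "blinfun_apply (Blinfun b) = b"
    by (rule bounded_linear_Blinfun_apply)
  show thesis
  proof (rule that)
    show "norm (Blinfun b) \<le> r"
      by (rule norm_blinfun_bound) (use \<open>0 \<le> r\<close> le in \<open>auto simp: app mult.commute\<close>)
  qed (simp add: app b)
qed

section \<open>Square roots near the identity\<close>

text \<open>Elements of the operator type are only real linear; the second clause restores complex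
  linearity. The two conditions are bundled because both are closed and survive the iteration for
  the square root.\<close>

definition commuting_selfadjoint :: "('a::chilbert_space \<Rightarrow>\<^sub>L 'a) \<Rightarrow> bool"
  where "commuting_selfadjoint B \<longleftrightarrow>
    (\<forall>x y. rinner (B x) y = rinner x (B y)) \<and> (\<forall>c x. B (c *\<^sub>C x) = c *\<^sub>C B x)"

lemma scaleC_bound: "norm (c *\<^sub>C x) = cmod c * norm (x::'a::complex_inner)"
proof (rule power2_eq_imp_eq)
  have "cnj c *\<^sub>C c *\<^sub>C x = (cmod c)\<^sup>2 *\<^sub>R x"
    by (simp add: scaleC_scaleC mult.commute complex_norm_square[symmetric] scaleC_of_real
        flip: of_real_power)
  then have "rinner (c *\<^sub>C x) (c *\<^sub>C x) = (cmod c)\<^sup>2 * rinner x x"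
    by (simp add: rinner_scaleC_left rinner.scaleR_right)
  then show "(norm (c *\<^sub>C x))\<^sup>2 = (cmod c * norm x)\<^sup>2"
    by (simp add: rinner_self power_mult_distrib)
qed auto

lemma scaleC_scaleR_commute: "c *\<^sub>C r *\<^sub>R x = r *\<^sub>R c *\<^sub>C (x::'a::complex_inner)"
  by (metis scaleC_of_real scaleC_scaleC mult.commute)

lemma bounded_linear_scaleC: "bounded_linear (\<lambda>x::'a::complex_inner. c *\<^sub>C x)"
  by (rule bounded_linear_intro[where K = "cmod c"])
    (auto simp: scaleC_add_right scaleC_scaleR_commute scaleC_bound mult.commute)

lemma scaleC_minus_right: "c *\<^sub>C (x - y) = c *\<^sub>C x - c *\<^sub>C (y::'a::complex_inner)"
  by (rule linear_diff[OF bounded_linear.linear[OF bounded_linear_scaleC]])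

text \<open>Each condition equates two continuous functions of the operator. Closedness lets the
  fixed point inherit the conditions.\<close>

lemma closed_commuting_selfadjoint: "closed (Collect commuting_selfadjoint)"
proof -
  have "closed {B::'a \<Rightarrow>\<^sub>L 'a. rinner (B x) y = rinner x (B y)}" for x y
    by (intro closed_Collect_eq continuous_intros rinner.continuous_on)
  moreover have "closed {B::'a \<Rightarrow>\<^sub>L 'a. B (c *\<^sub>C x) = c *\<^sub>C B x}" for c x
    by (intro closed_Collect_eq continuous_intros
        bounded_linear.continuous_on[OF bounded_linear_scaleC])
  ultimately show ?thesis
    unfolding commuting_selfadjoint_def
    by (intro closed_Collect_conj closed_Collect_all)
qed

text \<open>Writing the square root of \<open>1 - B\<close> as \<open>1 - Y\<close> turns the equation into
  \<open>Y = (B + Y\<^sup>2) / 2\<close>, a contraction on the ball of radius \<open>r\<close>.\<close>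

lemma sqrt_fixed_point:
  fixes B :: "'a::chilbert_space \<Rightarrow>\<^sub>L 'a"
  assumes B: "commuting_selfadjoint B" "norm B \<le> r" and r: "0 \<le> r" "r < 1"
  obtains Y where "commuting_selfadjoint Y" "norm Y \<le> r" "(1/2) *\<^sub>R (B + (Y o\<^sub>L Y)) = Y"
proof -
  define S where "S = {Y::'a \<Rightarrow>\<^sub>L 'a. commuting_selfadjoint Y} \<inter> cball 0 r"
  define F where "F Y = (1/2) *\<^sub>R (B + (Y o\<^sub>L Y))" for Y
  have "complete S"
    unfolding S_def complete_eq_closed
    by (intro closed_Int closed_cball) (use closed_commuting_selfadjoint in simp)
  moreover have "S \<noteq> {}"
    using B by (auto simp: S_def)
  moreover have "F ` S \<subseteq> S"
  proof
    fix Z assume "Z \<in> F ` S"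
    then obtain Y where Z: "Z = F Y" and Y: "commuting_selfadjoint Y" "norm Y \<le> r"
      by (auto simp: S_def)
    have "norm (Y o\<^sub>L Y) \<le> norm Y * norm Y"
      by (rule norm_blinfun_compose)
    also have "\<dots> \<le> r * 1"
      using Y r by (intro mult_mono) auto
    finally have "norm (Y o\<^sub>L Y) \<le> r"
      by simp
    then have "norm (B + (Y o\<^sub>L Y)) \<le> r + r"
      by (rule norm_triangle_mono[OF B(2)])
    then have "norm Z \<le> r"
      by (simp add: Z F_def)
    moreover have "commuting_selfadjoint Z"
      using B(1) Y(1)
      by (simp add: commuting_selfadjoint_def Z F_def blinfun.bilinear_simps rinner.add_left
          rinner.add_right rinner.scaleR_left rinner.scaleR_right scaleC_add_right
          scaleC_scaleR_commute)
    ultimately show "Z \<in> S"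
      by (simp add: S_def)
  qed
  moreover have "\<forall>X\<in>S. \<forall>Y\<in>S. dist (F X) (F Y) \<le> r * dist X Y"
  proof (intro ballI)
    fix X Y assume "X \<in> S" "Y \<in> S"
    then have le: "norm X \<le> r" "norm Y \<le> r"
      by (auto simp: S_def)
    \<comment> \<open>A factorisation of \<open>X\<^sup>2 - Y\<^sup>2\<close> that respects the
      order of the factors. Each summand costs \<open>r * norm (X - Y)\<close>, and the factor 1/2
      leaves the constant \<open>r\<close>.\<close>
    have "F X - F Y = (1/2) *\<^sub>R ((X o\<^sub>L (X - Y)) + ((X - Y) o\<^sub>L Y))"
      by (rule blinfun_eqI) (simp add: F_def blinfun.bilinear_simps algebra_simps)
    moreover have "norm (X o\<^sub>L (X - Y)) \<le> r * norm (X - Y)"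
      by (rule order_trans[OF norm_blinfun_compose]) (use le in \<open>simp add: mult_right_mono\<close>)
    moreover have "norm ((X - Y) o\<^sub>L Y) \<le> r * norm (X - Y)"
      by (rule order_trans[OF norm_blinfun_compose])
        (subst mult.commute, use le in \<open>simp add: mult_right_mono\<close>)
    ultimately show "dist (F X) (F Y) \<le> r * dist X Y"
      using norm_triangle_ineq[of "X o\<^sub>L (X - Y)" "(X - Y) o\<^sub>L Y"] by (simp add: dist_norm)
  qed
  ultimately obtain Y where "Y \<in> S" "F Y = Y"
    using Banach_fix[of S r F] r by metis
  then show thesis
    by (intro that) (auto simp: S_def F_def)
qed

text \<open>Surjectivity solves \<open>x = z + Y x\<close> by Banach's fixed point theorem;
  injectivity and the bound on the inverse come from
  \<open>(1 - r) * norm x \<le> norm (x - Y x)\<close>.\<close>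

lemma one_minus_contraction_inverse:
  fixes Y :: "'a::chilbert_space \<Rightarrow>\<^sub>L 'a"
  assumes "norm Y \<le> r" "r < 1"
  obtains L' where "bounded_linear L'" "\<And>x. L' (x - Y x) = x" "\<And>x. L' x - Y (L' x) = x"
proof -
  have Yr: "norm (Y x) \<le> r * norm x" for x
    by (rule order_trans[OF norm_blinfun]) (use assms in \<open>simp add: mult_right_mono\<close>)
  have lower: "(1 - r) * norm x \<le> norm (x - Y x)" for x
    using Yr[of x] norm_triangle_ineq2[of x "Y x"] by (simp add: algebra_simps)
  have r0: "0 \<le> r"
    using assms(1) norm_ge_zero order_trans by blast
  have "\<exists>x. x - Y x = z" for z
  proof -
    have "\<exists>!x. z + Y x = x"
      by (rule banach_fix_type[OF r0 \<open>r < 1\<close>])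
        (use Yr in \<open>auto simp: dist_norm simp flip: blinfun.diff_right\<close>)
    then obtain x where "z + Y x = x"
      by blast
    then show ?thesis
      by (intro exI[of _ x]) (simp add: diff_eq_eq)
  qed
  then obtain L' where right: "\<And>x. L' x - Y (L' x) = x"
    by metis
  have unique: "x = y" if "x - Y x = y - Y y" for x y
  proof -
    have "(x - y) - Y (x - y) = 0"
      using that by (simp add: blinfun.diff_right algebra_simps)
    then have "(1 - r) * norm (x - y) \<le> 0"
      using lower[of "x - y"] by simp
    then show ?thesis
      using \<open>r < 1\<close> by (simp add: mult_le_0_iff)
  qed
  have left: "L' (x - Y x) = x" for x
    by (rule unique) (rule right)
  have "bounded_linear L'"
  proof (rule bounded_linear_intro)
    show "L' (x + y) = L' x + L' y" for x y
      by (rule unique) (metis right add_diff_add blinfun.add_right)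
    show "L' (c *\<^sub>R x) = c *\<^sub>R L' x" for c x
      by (rule unique) (metis right scaleR_diff_right blinfun.scaleR_right)
    show "norm (L' x) \<le> norm x * (1 / (1 - r))" for x
      using lower[of "L' x"] \<open>r < 1\<close> by (simp add: right field_simps)
  qed
  then show thesis
    by (rule that[OF _ left right])
qed

section \<open>Limits along a subfilter\<close>

text \<open>A substitute for a Banach limit: one filter serves all \<open>z\<close> at once, whereas
  a diagonal subsequence would serve only countably many.\<close>

lemma bounded_family_subfilter_limit:
  fixes c :: "nat \<Rightarrow> 'b \<Rightarrow> real"
  assumes bound: "\<And>n z. \<bar>c n z\<bar> \<le> K z"
  obtains U \<phi> where "U \<noteq> bot" "U \<le> sequentially" "\<And>z. ((\<lambda>n. c n z) \<longlongrightarrow> \<phi> z) U"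
proof -
  define P where "P = (\<Pi>\<^sub>E z\<in>UNIV. {- K z..K z})"
  have "compactin (product_topology (\<lambda>_. euclidean) UNIV) P"
    unfolding P_def compactin_PiE by simp
  then have "compact P"
    by (simp add: euclidean_product_topology)
  moreover have "c n \<in> P" for n
    using bound by (auto simp: P_def abs_le_iff minus_le_iff)
  then have "eventually (\<lambda>f. f \<in> P) (filtermap c sequentially)"
    by (simp add: eventually_filtermap)
  moreover have "filtermap c sequentially \<noteq> bot"
    by (simp add: filtermap_bot_iff)
  ultimately obtain \<phi> where \<phi>: "inf (nhds \<phi>) (filtermap c sequentially) \<noteq> bot"
    unfolding compact_filter by metis
  \<comment> \<open>The neighbourhoods of a cluster point \<open>\<phi>\<close> are pulled back
    along \<open>c\<close>, so convergence holds by construction. If \<open>U\<close> were trivial,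
    some neighbourhood of \<open>\<phi>\<close> would eventually be avoided by
    \<open>c n\<close>.\<close>
  define U where "U = inf (filtercomap c (nhds \<phi>)) sequentially"
  have "U \<noteq> bot"
  proof
    assume "U = bot"
    then have "eventually (\<lambda>_. False) U"
      by simp
    then obtain Q R where Q: "eventually Q (filtercomap c (nhds \<phi>))"
      and R: "eventually R sequentially" and QR: "\<And>n. \<not> (Q n \<and> R n)"
      unfolding U_def eventually_inf by blast
    obtain Q' where Q': "eventually Q' (nhds \<phi>)" "\<And>n. Q' (c n) \<Longrightarrow> Q n"
      using Q unfolding eventually_filtercomap by blast
    have "eventually (\<lambda>f. \<not> Q' f) (filtermap c sequentially)"
      unfolding eventually_filtermap using R by eventually_elim (use Q' QR in blast)
    then have "eventually (\<lambda>_. False) (inf (nhds \<phi>) (filtermap c sequentially))"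
      unfolding eventually_inf using Q'(1) by blast
    then show False
      using \<phi> by (simp add: trivial_limit_def)
  qed
  moreover have "((\<lambda>n. c n z) \<longlongrightarrow> \<phi> z) U" for z
  proof -
    have "filterlim c (nhds \<phi>) U"
      unfolding U_def filterlim_iff_le_filtercomap by simp
    moreover have "((\<lambda>f. f z) \<longlongrightarrow> \<phi> z) (nhds \<phi>)"
    proof (rule topological_tendstoI)
      fix S :: "real set" assume "open S" "\<phi> z \<in> S"
      have "open ((\<lambda>f::'b \<Rightarrow> real. f z) -` S)"
        by (rule open_vimage[OF \<open>open S\<close> continuous_on_product_coordinates])
      then show "\<forall>\<^sub>F f in nhds \<phi>. f z \<in> S"
        unfolding eventually_nhds using \<open>\<phi> z \<in> S\<close> by (auto intro!: exI)
    qed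
    ultimately show ?thesis
      by (rule filterlim_compose[rotated])
  qed
  ultimately show thesis
    using that[of U \<phi>] by (simp add: U_def)
qed

section \<open>The invariant form\<close>

locale cesaro_bounded =
  fixes T :: "'a::chilbert_space \<Rightarrow> 'a" and m M :: real
  assumes bounded_clinear: "bounded_clinear T"
    and m_pos: "m > 0" and M_pos: "M > 0"
    and cesaro: "\<And>(N::nat) (x::'a). N \<ge> 1 \<Longrightarrow>
      m\<^sup>2 * (norm x)\<^sup>2 \<le> 1 / real N * (\<Sum>n<N. (norm ((T ^^ n) x))\<^sup>2) \<and>
      1 / real N * (\<Sum>n<N. (norm ((T ^^ n) x))\<^sup>2) \<le> M\<^sup>2 * (norm x)\<^sup>2"
begin

text \<open>The lower bound applied to \<open>T\<^sup>k x\<close> over the window of length \<open>k\<close>, together with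
  the upper bound for \<open>x\<close> over the window of length \<open>2 k\<close>.\<close>

lemma power_bounded: "m\<^sup>2 * (norm ((T ^^ k) x))\<^sup>2 \<le> 2 * M\<^sup>2 * (norm x)\<^sup>2" if "k \<ge> 1"
proof -
  let ?a = "\<lambda>n. (norm ((T ^^ n) x))\<^sup>2"
  have "m\<^sup>2 * ?a k \<le> 1 / real k * (\<Sum>n<k. ?a (n + k))"
    using cesaro[OF that, of "(T ^^ k) x"] by (simp add: funpow_add)
  also have "\<dots> \<le> 1 / real k * (\<Sum>n<2 * k. ?a n)"
  proof (intro mult_left_mono)
    have "(\<Sum>n<k. ?a (n + k)) = sum ?a ((\<lambda>n. n + k) ` {..<k})"
      by (subst sum.reindex) auto
    also have "\<dots> \<le> (\<Sum>n<2 * k. ?a n)"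
      by (rule sum_mono2) auto
    finally show "(\<Sum>n<k. ?a (n + k)) \<le> (\<Sum>n<2 * k. ?a n)" .
  qed simp
  also have "\<dots> = 2 * (1 / real (2 * k) * (\<Sum>n<2 * k. ?a n))"
    using that by simp
  also have "\<dots> \<le> 2 * (M\<^sup>2 * (norm x)\<^sup>2)"
    using cesaro[of "2 * k" x] that by simp
  finally show ?thesis
    by simp
qed

definition cesaro_form :: "nat \<Rightarrow> 'a \<Rightarrow> 'a \<Rightarrow> real"
  where "cesaro_form N x y = 1 / real N * (\<Sum>n<N. rinner ((T ^^ n) x) ((T ^^ n) y))"

lemma bounded_linear_funpow: "bounded_linear (T ^^ n)"
proof (induction n)
  case 0
  show ?case
    by (simp add: id_def bounded_linear_ident)
next
  case (Suc n)
  then show ?case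
    using bounded_clinear bounded_linear_compose[of T "T ^^ n"]
    by (simp add: bounded_clinear_def comp_def)
qed

lemma funpow_scaleC: "(T ^^ n) (c *\<^sub>C x) = c *\<^sub>C (T ^^ n) x"
  using bounded_clinear by (induction n) (auto simp: bounded_clinear_def)

lemma cesaro_form_commute: "cesaro_form N x y = cesaro_form N y x"
  unfolding cesaro_form_def by (subst rinner_commute) simp

lemma cesaro_form_add_left: "cesaro_form N (x + y) z = cesaro_form N x z + cesaro_form N y z"
  by (simp add: cesaro_form_def linear_add[OF bounded_linear.linear[OF bounded_linear_funpow]] rinner.add_left
      sum.distrib distrib_left add_divide_distrib)

lemma cesaro_form_scaleR_left: "cesaro_form N (r *\<^sub>R x) y = r * cesaro_form N x y"
  by (simp add: cesaro_form_def linear_scale[OF bounded_linear.linear[OF bounded_linear_funpow]]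
      rinner.scaleR_left flip: sum_distrib_left)

lemma bilinear_cesaro_form: "bilinear (cesaro_form N)"
  by (rule bilinear_symmetricI)
    (auto simp: cesaro_form_add_left cesaro_form_scaleR_left intro: cesaro_form_commute)

lemma cesaro_form_scaleC_left: "cesaro_form N (c *\<^sub>C x) y = cesaro_form N x (cnj c *\<^sub>C y)"
  by (simp add: cesaro_form_def funpow_scaleC rinner_scaleC_left)

lemma cesaro_form_self: "cesaro_form N x x = 1 / real N * (\<Sum>n<N. (norm ((T ^^ n) x))\<^sup>2)"
  by (simp add: cesaro_form_def rinner_self)

text \<open>The bound is uniform in \<open>N\<close>, as the passage to the limit requires.\<close>

lemma cesaro_form_bound: "\<bar>cesaro_form N x y\<bar> \<le> M\<^sup>2 * norm x * norm y"
proof (rule psd_form_bound[OF bilinear_cesaro_form cesaro_form_commute])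
  \<comment> \<open>For \<open>N = 0\<close> the form vanishes because
    \<open>1 / 0 = 0\<close>.\<close>
  show "cesaro_form N x x \<le> M\<^sup>2 * (norm x)\<^sup>2" for x
    using cesaro[of N x] by (cases "N = 0") (auto simp: cesaro_form_self)
qed (auto simp: cesaro_form_self sum_nonneg)

text \<open>The difference telescopes to two boundary terms divided by \<open>N\<close>, and power
  boundedness controls the one that depends on \<open>N\<close>.\<close>

lemma cesaro_form_almost_invariant:
  "(\<lambda>N. cesaro_form N (T x) (T x) - cesaro_form N x x) \<longlonglongrightarrow> 0"
proof (rule tendsto_0_le)
  let ?C = "2 * M\<^sup>2 * (norm x)\<^sup>2 / m\<^sup>2 + (norm x)\<^sup>2"
  show "(\<lambda>N. 1 / real N) \<longlonglongrightarrow> 0"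
    by (rule lim_1_over_n)
  show "\<forall>\<^sub>F N in sequentially.
    norm (cesaro_form N (T x) (T x) - cesaro_form N x x) \<le> norm (1 / real N) * ?C"
    using eventually_ge_at_top[of 1]
  proof eventually_elim
    fix N :: nat assume "1 \<le> N"
    let ?a = "\<lambda>n. (norm ((T ^^ n) x))\<^sup>2"
    have "cesaro_form N (T x) (T x) - cesaro_form N x x
      = 1 / real N * (\<Sum>n<N. ?a (Suc n) - ?a n)"
      by (simp add: cesaro_form_self funpow_swap1 sum_subtractf diff_divide_distrib)
    also have "(\<Sum>n<N. ?a (Suc n) - ?a n) = ?a N - ?a 0"
      by (rule sum_lessThan_telescope)
    finally have eq: "cesaro_form N (T x) (T x) - cesaro_form N x x
      = 1 / real N * (?a N - (norm x)\<^sup>2)"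
      by simp
    have "?a N \<le> 2 * M\<^sup>2 * (norm x)\<^sup>2 / m\<^sup>2"
      using power_bounded[OF \<open>1 \<le> N\<close>, of x] m_pos by (simp add: field_simps)
    then have "\<bar>?a N - (norm x)\<^sup>2\<bar> \<le> ?C"
      using abs_triangle_ineq4[of "?a N" "(norm x)\<^sup>2"] by simp
    then have "norm (1 / real N) * \<bar>?a N - (norm x)\<^sup>2\<bar> \<le> norm (1 / real N) * ?C"
      by (intro mult_left_mono) auto
    then show "norm (cesaro_form N (T x) (T x) - cesaro_form N x x) \<le> norm (1 / real N) * ?C"
      unfolding eq by (simp add: abs_mult)
  qed
qed

text \<open>All the properties pass to the limit along one filter; almost invariance becomes exact
  because that filter refines \<open>sequentially\<close>.\<close>

lemma invariant_form:
  obtains b where "bilinear b" "\<And>x y. b x y = b y x" "\<And>c x y. b (c *\<^sub>C x) y = b x (cnj c *\<^sub>C y)"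
    "\<And>x. m\<^sup>2 * (norm x)\<^sup>2 \<le> b x x" "\<And>x. b x x \<le> M\<^sup>2 * (norm x)\<^sup>2" "\<And>x. b (T x) (T x) = b x x"
proof -
  obtain U \<phi> where U: "U \<noteq> bot" "U \<le> sequentially"
    and lim: "\<And>z. ((\<lambda>N. cesaro_form N (fst z) (snd z)) \<longlongrightarrow> \<phi> z) U"
    \<comment> \<open>Indexing by pairs makes the forms converge for all arguments along the same
      filter.\<close>
    using bounded_family_subfilter_limit[of "\<lambda>N z. cesaro_form N (fst z) (snd z)"
        "\<lambda>z. M\<^sup>2 * norm (fst z) * norm (snd z)"] cesaro_form_bound
    by metis
  define b where "b x y = \<phi> (x, y)" for x y
  have b: "((\<lambda>N. cesaro_form N x y) \<longlongrightarrow> b x y) U" for x y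
    using lim[of "(x, y)"] by (simp add: b_def)
  note uniq = tendsto_unique[OF U(1)]
  have commute: "b x y = b y x" for x y
    by (rule uniq[OF b]) (subst cesaro_form_commute, rule b)
  have add: "b (x + y) z = b x z + b y z" for x y z
    by (rule uniq[OF b]) (subst cesaro_form_add_left, intro tendsto_intros b)
  have scale: "b (r *\<^sub>R x) y = r * b x y" for r x y
    by (rule uniq[OF b]) (subst cesaro_form_scaleR_left, intro tendsto_intros b)
  have ev: "\<forall>\<^sub>F N in U. N \<ge> 1"
    using eventually_ge_at_top[of 1] U(2) by (rule filter_leD[rotated])
  show thesis
  proof
    show "bilinear b"
      by (rule bilinear_symmetricI) (auto simp: add scale intro: commute)
    show "b x y = b y x" for x y
      by (rule commute)
    show "b (c *\<^sub>C x) y = b x (cnj c *\<^sub>C y)" for c x y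
      by (rule uniq[OF b]) (subst cesaro_form_scaleC_left, rule b)
    show "m\<^sup>2 * (norm x)\<^sup>2 \<le> b x x" for x
      by (rule tendsto_lowerbound[OF b _ U(1)])
        (use ev in eventually_elim, use cesaro in \<open>auto simp: cesaro_form_self\<close>)
    show "b x x \<le> M\<^sup>2 * (norm x)\<^sup>2" for x
      by (rule tendsto_upperbound[OF b _ U(1)])
        (use ev in eventually_elim, use cesaro in \<open>auto simp: cesaro_form_self\<close>)
    show "b (T x) (T x) = b x x" for x
    proof -
      have "b (T x) (T x) - b x x = 0"
        by (rule uniq[OF tendsto_diff[OF b b]])
          (rule tendsto_mono[OF U(2) cesaro_form_almost_invariant])
      then show ?thesis by simp
    qed
  qed
qed

end

section \<open>The similarity built from the invariant form\<close>

theorem corollary4p1: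
  fixes T :: "'a::chilbert_space \<Rightarrow> 'a"
    and m M :: real
  assumes "bounded_clinear T"
    and "m > 0" and "M > 0"
    and "\<And>(N::nat) (x::'a). N \<ge> 1 \<Longrightarrow>
      m\<^sup>2 * (norm x)\<^sup>2 \<le> 1 / real N * (\<Sum>n<N. (norm ((T ^^ n) x))\<^sup>2) \<and>
      1 / real N * (\<Sum>n<N. (norm ((T ^^ n) x))\<^sup>2) \<le> M\<^sup>2 * (norm x)\<^sup>2"
  shows "similar_to_isometry T"
proof -
  interpret cesaro_bounded T m M
    using assms by unfold_locales
  obtain b where bil: "bilinear b" and commute: "\<And>x y. b x y = b y x"
    and scaleC: "\<And>c x y. b (c *\<^sub>C x) y = b x (cnj c *\<^sub>C y)"
    and lower: "\<And>x. m\<^sup>2 * (norm x)\<^sup>2 \<le> b x x" and upper: "\<And>x. b x x \<le> M\<^sup>2 * (norm x)\<^sup>2"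
    and invariant: "\<And>x. b (T x) (T x) = b x x"
    using invariant_form by blast
  \<comment> \<open>The maximum with \<open>0\<close> matters only when the space is trivial, where \<open>m > M\<close> is possible.\<close>
  define r where "r = max 0 (1 - m\<^sup>2 / M\<^sup>2)"
  have r: "0 \<le> r" "r < 1"
    using \<open>m > 0\<close> \<open>M > 0\<close> by (auto simp: r_def)
  \<comment> \<open>The form of \<open>B\<close>, where \<open>1 - B\<close> represents
    \<open>b\<close> divided by \<open>M\<^sup>2\<close>. The upper bound on \<open>b\<close> makes
    it nonnegative, and the lower bound keeps it at most \<open>r < 1\<close> times the squared
    norm.\<close>
  define \<beta> where "\<beta> x y = rinner x y - b x y / M\<^sup>2" for x y
  have commute_\<beta>: "\<beta> x y = \<beta> y x" for x y
    using commute[of x y] rinner_commute[of x y] by (simp add: \<beta>_def)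
  have bil_\<beta>: "bilinear \<beta>"
    by (rule bilinear_symmetricI[OF commute_\<beta>])
      (simp_all add: \<beta>_def rinner.add_left rinner.scaleR_left bilinear_ladd[OF bil]
        bilinear_lmul[OF bil] add_divide_distrib right_diff_distrib)
  have nonneg_\<beta>: "0 \<le> \<beta> x x" for x
    using upper[of x] \<open>M > 0\<close> by (simp add: \<beta>_def rinner_self field_simps)
  have upper_\<beta>: "\<beta> x x \<le> r * (norm x)\<^sup>2" for x
  proof -
    have "\<beta> x x \<le> (1 - m\<^sup>2 / M\<^sup>2) * (norm x)\<^sup>2"
      using lower[of x] \<open>M > 0\<close> by (simp add: \<beta>_def rinner_self field_simps)
    also have "\<dots> \<le> r * (norm x)\<^sup>2"
      by (rule mult_right_mono) (auto simp: r_def)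
    finally show ?thesis .
  qed
  obtain B :: "'a \<Rightarrow>\<^sub>L 'a" where B: "norm B \<le> r" "\<And>x y. rinner (B x) y = \<beta> x y"
    using bounded_form_operator[OF bil_\<beta> psd_form_bound[OF bil_\<beta> commute_\<beta> nonneg_\<beta> upper_\<beta> r(1)] r(1)]
    by blast
  have "commuting_selfadjoint B"
    unfolding commuting_selfadjoint_def
  proof (intro conjI allI)
    show "rinner (B x) y = rinner x (B y)" for x y
      by (metis B(2) commute_\<beta> rinner_commute)
    show "B (c *\<^sub>C x) = c *\<^sub>C B x" for c x
      by (rule rinner_left_cancel) (simp add: B(2) rinner_scaleC_left, simp add: \<beta>_def rinner_scaleC_left scaleC)
  qed
  then obtain Y where Y: "commuting_selfadjoint Y" "norm Y \<le> r"
    and fix_Y: "(1/2) *\<^sub>R (B + (Y o\<^sub>L Y)) = Y"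
    using sqrt_fixed_point B(1) r by blast
  define L where "L x = x - Y x" for x
  obtain L' where L': "bounded_linear L'" "\<And>x. L' (L x) = x" "\<And>x. L (L' x) = x"
    using one_minus_contraction_inverse[OF Y(2) r(2)] unfolding L_def by metis
  have L_scaleC: "L (c *\<^sub>C x) = c *\<^sub>C L x" for c x
    using Y(1) by (simp add: L_def commuting_selfadjoint_def scaleC_minus_right)
  have "bounded_clinear L"
    unfolding bounded_clinear_def
    by (auto simp: L_scaleC) (auto simp: L_def[abs_def] intro!: bounded_linear_sub bounded_linear_ident blinfun.bounded_linear_right)
  moreover have "L' (c *\<^sub>C x) = c *\<^sub>C L' x" for c x
    by (metis L'(2,3) L_scaleC)
  then have "bounded_clinear L'"
    using L'(1) by (simp add: bounded_clinear_def)
  \<comment> \<open>The fixed point equation says that \<open>L\<close> squares to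
    \<open>1 - B\<close>; selfadjointness moves one factor \<open>L\<close> across the inner
    product.\<close>
  moreover have norm_L: "(norm (L x))\<^sup>2 = b x x / M\<^sup>2" for x
  proof -
    have "B x = 2 *\<^sub>R Y x - Y (Y x)"
      using arg_cong[OF fix_Y, of "\<lambda>Z. blinfun_apply (2 *\<^sub>R Z) x"]
      by (simp add: blinfun.bilinear_simps eq_diff_eq)
    then have "L (L x) = x - B x"
      by (simp add: L_def blinfun.bilinear_simps scaleR_2 algebra_simps)
    moreover have "rinner (L x) (L x) = rinner (L (L x)) x"
      using Y(1) by (simp add: L_def commuting_selfadjoint_def rinner.diff_left rinner.diff_right)
    ultimately show ?thesis
      by (simp add: rinner_self[symmetric] rinner.diff_left B(2)) (simp add: \<beta>_def)
  qed
  \<comment> \<open>\<open>norm_L\<close> converts both norms to \<open>b\<close>, whose invariance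
    removes \<open>T\<close>.\<close>
  have "norm (L (T (L' x))) = norm x" for x
  proof (rule power2_eq_imp_eq)
    show "(norm (L (T (L' x))))\<^sup>2 = (norm x)\<^sup>2"
      using norm_L[of "L' x"] by (simp add: norm_L invariant L'(3))
  qed auto
  ultimately show ?thesis
    unfolding similar_to_isometry_def
    \<comment> \<open>The isometry is \<open>L T L'\<close>, so the two operators enter the
      definition in swapped roles.\<close>
    by (intro exI[of _ L'] exI[of _ L]) (auto simp: L' fun_eq_iff)
qed

end
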